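(* The following identities of formal power series in $z$ (with coefficients in $\mathbb{Z}[q]$) hold: $$F(312;q,z)=\frac{1}{1-zF(231;q,z)},$$ $$F(312,123;q,z)=1+\left(\frac{z}{1-z}\right)^2+zF(231,123;q,z),$$ and, for all $(\tau,\tau')\in\{132,213\}^2$, $$F(312,\tau;q,z)=1+\left(\frac{z}{1-z}\right)F(231,\tau';q,z).$$
   Context: $S_n$ is the set of permutations $\sigma=\sigma(1)\cdots\sigma(n)$ of $[n]=\{1,\dots,n\}$ ($S_0$ consists of the empty permutation), and $|\sigma|=n$ for $\sigma\in S_n$. A crossing of $\sigma$ is a pair of indices $(i,j)$ such that $i<j<\sigma(i)<\sigma(j)$ or $\sigma(i)<\sigma(j)\leq i<j$; $\mathrm{cr}(\sigma)$ is the number of crossings of $\sigma$. A permutation $\sigma$ avoids a pattern $\tau\in S_m$ if there are no indices $i_1<\cdots<i_m$ such that $\sigma(i_1)\cdots\sigma(i_m)$ is order isomorphic to $\tau$. For a set $T$ of patterns, $S_n(T)$ is the set of $\sigma\in S_n$ avoiding every pattern in $T$, $S(T)=\bigcup_{n\ge 0}S_n(T)$, and $F(T;q,z)=\sum_{\sigma\in S(T)}q^{\mathrm{cr}(\sigma)}z^{|\sigma|}$. Set braces around listed patterns are omitted, e.g. $F(312,123;q,z)=F(\{312,123\};q,z)$. Patterns are written in one-line notation. *)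

theory Defs
  imports
    "HOL-Computational_Algebra.Computational_Algebra"
    "HOL-Combinatorics.Combinatorics"
begin

text \<open>A permutation of \<open>{1..n}\<close> is given by its one-line notation, i.e. the list
  \<open>[\<sigma>(1), \<dots>, \<sigma>(n)]\<close>, so that \<open>\<bar>\<sigma>\<bar>\<close> is \<open>length \<sigma>\<close>.
  Indices are 1-based as usual for permutations, whereas list positions are 0-based.\<close>

definition entry :: "nat list \<Rightarrow> nat \<Rightarrow> nat" where
  "entry \<sigma> i = \<sigma> ! (i - 1)"

definition crossings :: "nat list \<Rightarrow> (nat \<times> nat) set" where
  "crossings \<sigma> = {(i, j). i \<in> {1..length \<sigma>} \<and> j \<in> {1..length \<sigma>} \<and>
     ((i < j \<and> j < entry \<sigma> i \<and> entry \<sigma> i < entry \<sigma> j) \<or>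
      (entry \<sigma> i < entry \<sigma> j \<and> entry \<sigma> j \<le> i \<and> i < j))}"

definition cr :: "nat list \<Rightarrow> nat" where
  "cr \<sigma> = card (crossings \<sigma>)"

definition order_isomorphic :: "nat list \<Rightarrow> nat list \<Rightarrow> bool" where
  "order_isomorphic xs ys \<longleftrightarrow> length xs = length ys \<and>
     (\<forall>a < length xs. \<forall>b < length xs. xs ! a < xs ! b \<longleftrightarrow> ys ! a < ys ! b)"

text \<open>The list \<open>is\<close> below is an increasing sequence of indices \<open>i\<^sub>1 < \<dots> < i\<^sub>m\<close>.\<close>

definition avoids :: "nat list \<Rightarrow> nat list \<Rightarrow> bool" where
  "avoids \<sigma> \<tau> \<longleftrightarrow> \<not> (\<exists>is. sorted_wrt (<) is \<and> set is \<subseteq> {1..length \<sigma>} \<and>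
     order_isomorphic (map (entry \<sigma>) is) \<tau>)"

definition avoiders :: "nat list set \<Rightarrow> nat \<Rightarrow> nat list set" where
  "avoiders T n = {\<sigma> \<in> permutations_of_set {1..n}. \<forall>\<tau>\<in>T. avoids \<sigma> \<tau>}"

text \<open>The generating function \<open>F(T; q, z)\<close> in \<open>\<int>[q][[z]]\<close>: the polynomial variable is \<open>q\<close>,
  the power series variable is \<open>z\<close>.\<close>

definition F :: "nat list set \<Rightarrow> int poly fps" where
  "F T = Abs_fps (\<lambda>n. \<Sum>\<sigma>\<in>avoiders T n. monom 1 (cr \<sigma>))"

text \<open>The division of \<^typ>\<open>'a fps\<close> in the library requires inverses of coefficients, which
  \<^typ>\<open>int poly\<close> lacks. Division by a power series with constant coefficient 1 makes sense over
  any commutative ring; the argument \<open>1\<close> of \<^const>\<open>fps_right_inverse\<close> is the inverse of that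
  constant coefficient.\<close>

definition fps_quot :: "'a :: comm_ring_1 fps \<Rightarrow> 'a fps \<Rightarrow> 'a fps" where
  "fps_quot f g = f * fps_right_inverse g 1"

lemma fps_quot_mult:
  assumes "fps_nth g 0 = 1"
  shows "fps_quot f g * g = f"
  using fps_right_inverse[of g 1] assms by (simp add: fps_quot_def mult_ac)

lemma fps_quot_unique:
  assumes "fps_nth g 0 = 1" and "h * g = f"
  shows "h = fps_quot f g"
  using fps_right_inverse[of g 1] assms by (auto simp: fps_quot_def mult.assoc)

end

theory Submission
  imports Defs
begin

text \<open>A permutation avoiding 312 is cut at its minimum: an entry before the 1 that exceeded an entry
  after it would form a 312 with that 1, so \<open>\<sigma> = (A 1) \<oplus> B\<close>, where \<open>A\<close> and \<open>B\<close> avoid 312 and all of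
  \<open>B\<close> lies above and to the right of \<open>A 1\<close>. A crossing requires \<open>i < j\<close>, \<open>\<sigma>(i) < \<sigma>(j)\<close> and an overlap of
  the two arcs, so there are none between the two summands, and none involving the 1. Those of \<open>B\<close>
  are unchanged by the shift along the diagonal. In \<open>A\<close>, however, values are raised by one while
  positions stay, which moves the places of the strict and the weak inequality in the definition of a
  crossing: what is counted are the crossings of \<open>A\<inverse>\<close>, which avoids 231. This gives
  \<open>F(312) = 1 + z F(231) F(312)\<close>.

  With a second pattern \<open>\<tau>\<close>, two cases differ. If \<open>B\<close> is empty, \<open>A\<close> is any \<open>{312, \<tau>}\<close>-avoider, which
  contributes \<open>z F(231, \<tau>)\<close> because each of 123, 132 and 213 is an involution. If \<open>B\<close> is nonempty,
  \<open>A\<close> and \<open>B\<close> exclude structure in each other (\<open>avoids3_glue\<close>):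
  \<open>A\<close> and \<open>B\<close> are decreasing for \<open>\<tau> = 123\<close>;
  \<open>A\<close> is any \<open>{312, \<tau>}\<close>-avoider and \<open>B\<close> is increasing for \<open>\<tau> = 132\<close>;
  \<open>A\<close> is empty and \<open>B\<close> is any \<open>{312, \<tau>}\<close>-avoider for \<open>\<tau> = 213\<close>.
  The monotone permutations contribute geometric series, having no crossings to count. All these
  cases are instances of \<open>glue_functional_equation\<close>.

  The choice of \<open>\<tau>'\<close> in the last identity is free because \<open>F(231, 132) = F(231, 213)\<close>: taking
  inverses and taking the reverse complement both exchange weak and strict inequalities in the
  definition of a crossing, so the composite preserves the number of crossings; it fixes 231 and
  exchanges 132 with 213.\<close>

section \<open>Permutations as functions\<close>

text \<open>Permutations of \<open>{1..n}\<close> are replaced by functions permuting \<open>{..<n}\<close>, for which inverses and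
  composition are at hand. Crossings and patterns only compare positions and values with each other,
  so starting both at 0 changes nothing.\<close>

definition one_line :: "nat \<Rightarrow> (nat \<Rightarrow> nat) \<Rightarrow> nat list" where
  "one_line n p = map (\<lambda>i. Suc (p i)) [0..<n]"

definition avoids3 :: "nat \<Rightarrow> (nat \<Rightarrow> nat) \<Rightarrow> nat list \<Rightarrow> bool" where
  "avoids3 n p \<tau> \<longleftrightarrow> (\<forall>i j k. i < j \<longrightarrow> j < k \<longrightarrow> k < n \<longrightarrow> \<not> order_isomorphic [p i, p j, p k] \<tau>)"

definition av_perms :: "nat list set \<Rightarrow> nat \<Rightarrow> (nat \<Rightarrow> nat) set" where
  "av_perms T n = {p. p permutes {..<n} \<and> (\<forall>\<tau>\<in>T. avoids3 n p \<tau>)}"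

definition crosses :: "nat \<Rightarrow> (nat \<Rightarrow> nat) \<Rightarrow> (nat \<times> nat) set" where
  "crosses n p = {(i, j). i < j \<and> j < n \<and> p i < p j \<and> (j < p i \<or> p j \<le> i)}"

text \<open>The same condition with weak and strict inequality exchanged, which makes these the crossings of
  the inverse permutation (\<open>card_crosses_inverse\<close>).\<close>

definition dual_crosses :: "nat \<Rightarrow> (nat \<Rightarrow> nat) \<Rightarrow> (nat \<times> nat) set" where
  "dual_crosses n p = {(i, j). i < j \<and> j < n \<and> p i < p j \<and> (j \<le> p i \<or> p j < i)}"

text \<open>The statistic and the class of permutations are parameters since both kinds of crossings, and
  classes not given by patterns, occur in the functional equation.\<close>

definition series :: "(nat \<Rightarrow> (nat \<Rightarrow> nat) \<Rightarrow> (nat \<times> nat) set) \<Rightarrow> (nat \<Rightarrow> (nat \<Rightarrow> nat) set)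
    \<Rightarrow> int poly fps" where
  "series C X = Abs_fps (\<lambda>n. \<Sum>p\<in>X n. monom 1 (card (C n p)))"

lemma series_nth: "fps_nth (series C X) n = (\<Sum>p\<in>X n. monom 1 (card (C n p)))"
  by (simp add: series_def)

lemma finite_crosses: "finite (crosses n p)" "finite (dual_crosses n p)"
  by (rule finite_subset[of _ "{..<n} \<times> {..<n}"]; force simp: crosses_def dual_crosses_def)+

lemma finite_perms_less: "finite {p. p permutes {..<n::nat}}"
  by (simp add: finite_permutations)

lemma permutes_lessD:
  assumes "p permutes {..<n::nat}" "i < n" shows "p i < n"
  using permutes_in_image[OF assms(1), of i] assms(2) by simp

lemma permutes_less_eqD:
  assumes "p permutes {..<n::nat}" "p i = p j" shows "i = j"
  using permutes_inj[OF assms(1)] assms(2) by (simp add: inj_eq)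

lemma less3_cases: "(\<forall>a<Suc (Suc (Suc 0)). P a) \<longleftrightarrow> P 0 \<and> P (Suc 0) \<and> P (Suc (Suc 0))"
  by (auto simp: less_Suc_eq)

lemma order_isomorphic_3:
  "order_isomorphic [a, b, c] [3,1,2] \<longleftrightarrow> b < c \<and> c < a"
  "order_isomorphic [a, b, c] [2,3,1] \<longleftrightarrow> c < a \<and> a < b"
  "order_isomorphic [a, b, c] [1,2,3] \<longleftrightarrow> a < b \<and> b < c"
  "order_isomorphic [a, b, c] [1,3,2] \<longleftrightarrow> a < c \<and> c < b"
  "order_isomorphic [a, b, c] [2,1,3] \<longleftrightarrow> b < a \<and> a < c"
  unfolding order_isomorphic_def by (auto simp: less3_cases)

lemma entry_one_line: "i \<in> {1..n} \<Longrightarrow> entry (one_line n p) i = Suc (p (i - 1))"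
  by (auto simp: entry_def one_line_def)

lemma length_one_line [simp]: "length (one_line n p) = n"
  by (simp add: one_line_def)

lemma order_isomorphic_Suc:
  "order_isomorphic (map Suc xs) \<tau> \<longleftrightarrow> order_isomorphic xs \<tau>"
  by (auto simp: order_isomorphic_def)

lemma avoids_one_line:
  assumes "length \<tau> = 3"
  shows "avoids (one_line n p) \<tau> \<longleftrightarrow> avoids3 n p \<tau>"
proof -
  have "(\<exists>is. sorted_wrt (<) is \<and> set is \<subseteq> {1..n} \<and>
     order_isomorphic (map (entry (one_line n p)) is) \<tau>) \<longleftrightarrow>
    (\<exists>i j k. i < j \<and> j < k \<and> k < n \<and> order_isomorphic [p i, p j, p k] \<tau>)" (is "?L \<longleftrightarrow> ?R")
  proof
    assume ?L
    then obtain xs where xs: "sorted_wrt (<) xs" "set xs \<subseteq> {1..n}"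
      "order_isomorphic (map (entry (one_line n p)) xs) \<tau>" by blast
    then have "length xs = 3" using assms by (simp add: order_isomorphic_def)
    then obtain i j k where [simp]: "xs = [i, j, k]"
      by (auto simp: numeral_3_eq_3 length_Suc_conv)
    have "order_isomorphic (map Suc [p (i - 1), p (j - 1), p (k - 1)]) \<tau>"
      using xs by (simp add: entry_one_line)
    moreover have "i - 1 < j - 1" "j - 1 < k - 1" "k - 1 < n" using xs by auto
    ultimately show ?R unfolding order_isomorphic_Suc by blast
  next
    assume ?R
    then obtain i j k where *: "i < j" "j < k" "k < n" "order_isomorphic [p i, p j, p k] \<tau>"
      by blast
    have "order_isomorphic (map Suc [p i, p j, p k]) \<tau>"
      using * unfolding order_isomorphic_Suc by blast
    then have "order_isomorphic (map (entry (one_line n p)) [Suc i, Suc j, Suc k]) \<tau>"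
      using * by (simp add: entry_one_line)
    moreover have "sorted_wrt (<) [Suc i, Suc j, Suc k]" "set [Suc i, Suc j, Suc k] \<subseteq> {1..n}"
      using * by auto
    ultimately show ?L by blast
  qed
  then show ?thesis unfolding avoids_def avoids3_def by auto
qed

lemma cr_one_line: "cr (one_line n p) = card (crosses n p)"
proof -
  have "crossings (one_line n p) = map_prod Suc Suc ` crosses n p"
  proof (intro equalityI subsetI)
    fix x assume "x \<in> crossings (one_line n p)"
    then obtain i j where x: "x = (i, j)" "i \<in> {1..n}" "j \<in> {1..n}"
      "(i < j \<and> j < Suc (p (i - 1)) \<and> p (i - 1) < p (j - 1)) \<or>
       (p (i - 1) < p (j - 1) \<and> Suc (p (j - 1)) \<le> i \<and> i < j)"
      by (auto simp: crossings_def entry_one_line)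
    then have "(i - 1, j - 1) \<in> crosses n p" by (auto simp: crosses_def)
    moreover have "x = map_prod Suc Suc (i - 1, j - 1)" using x by simp
    ultimately show "x \<in> map_prod Suc Suc ` crosses n p" by blast
  qed (auto simp: crossings_def crosses_def entry_one_line)
  then show ?thesis
    by (simp add: cr_def card_image prod.inj_map inj_on_subset[OF prod.inj_map])
qed

lemma bij_betw_one_line: "bij_betw (one_line n) {p. p permutes {..<n}} (permutations_of_set {1..n})"
proof (rule bij_betwI')
  fix p q assume "p \<in> {p. p permutes {..<n}}" "q \<in> {p. p permutes {..<n}}"
  then have p: "p permutes {..<n}" "q permutes {..<n}" by auto
  show "one_line n p = one_line n q \<longleftrightarrow> p = q"
  proof
    assume "one_line n p = one_line n q"
    then have "\<forall>i<n. p i = q i" by (auto simp: one_line_def)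
    moreover have "\<forall>i. \<not> i < n \<longrightarrow> p i = q i" using p by (simp add: permutes_def)
    ultimately show "p = q" by auto
  qed simp
next
  fix p assume "p \<in> {p. p permutes {..<n}}"
  then have p: "p permutes {..<n}" by auto
  have "set (one_line n p) = Suc ` (p ` {..<n})" by (auto simp: one_line_def)
  also have "\<dots> = {1..n}"
    by (simp only: permutes_image[OF p] image_Suc_lessThan)
  finally have "set (one_line n p) = {1..n}" .
  moreover have "distinct (one_line n p)"
    using permutes_less_eqD[OF p] by (auto simp: one_line_def distinct_map inj_on_def)
  ultimately show "one_line n p \<in> permutations_of_set {1..n}" by (simp add: permutations_of_set_def)
next
  fix \<sigma> assume "\<sigma> \<in> permutations_of_set {1..n}"
  then have s: "set \<sigma> = {1..n}" "distinct \<sigma>" by (auto simp: permutations_of_set_def)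
  then have len: "length \<sigma> = n" using distinct_card by fastforce
  define p where "p = (\<lambda>i. if i < n then \<sigma> ! i - 1 else i)"
  have in_n: "1 \<le> \<sigma> ! i \<and> \<sigma> ! i \<le> n" if "i < n" for i
    using that s len nth_mem[of i \<sigma>] by auto
  have "p permutes {..<n}"
  proof (rule inj_imp_permutes)
    show "inj_on p {..<n}"
    proof (rule inj_onI)
      fix i j assume "i \<in> {..<n}" "j \<in> {..<n}" "p i = p j"
      then have "i < n" "j < n" "\<sigma> ! i = \<sigma> ! j" using in_n[of i] in_n[of j] by (auto simp: p_def)
      then show "i = j" using s len nth_eq_iff_index_eq by blast
    qed
    show "p x \<in> {..<n}" if "x \<in> {..<n}" for x using in_n[of x] that by (auto simp: p_def)
  qed (auto simp: p_def)
  moreover have "\<sigma> = one_line n p"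
    using in_n len by (force intro!: nth_equalityI simp: one_line_def p_def)
  ultimately show "\<exists>p\<in>{p. p permutes {..<n}}. \<sigma> = one_line n p" by blast
qed

lemma F_eq_series:
  assumes "\<And>\<tau>. \<tau> \<in> T \<Longrightarrow> length \<tau> = 3"
  shows "F T = series crosses (av_perms T)"
proof -
  have "bij_betw (one_line n) (av_perms T n) (avoiders T n)" for n
  proof (rule bij_betw_subset[OF bij_betw_one_line])
    have "avoiders T n = {\<sigma> \<in> one_line n ` {p. p permutes {..<n}}. \<forall>\<tau>\<in>T. avoids \<sigma> \<tau>}"
      by (simp only: avoiders_def bij_betw_imp_surj_on[OF bij_betw_one_line[of n]])
    also have "\<dots> = one_line n ` av_perms T n"
      using avoids_one_line[OF assms] by (auto simp: av_perms_def)
    finally show "one_line n ` av_perms T n = avoiders T n" ..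
  qed (auto simp: av_perms_def)
  then have "(\<Sum>p\<in>av_perms T n. monom 1 (cr (one_line n p)))
      = (\<Sum>\<sigma>\<in>avoiders T n. monom (1::int) (cr \<sigma>))" for n
    by (rule sum.reindex_bij_betw)
  then show ?thesis by (simp add: F_def series_def cr_one_line)
qed

section \<open>Inverse and reverse-complement\<close>

text \<open>An occurrence of a pattern, with its positions and values interchanged, is an occurrence of the
  inverse pattern in the inverse permutation; here 312 and 231 are inverse to each
  other and 123, 132 and 213 to themselves.\<close>

lemma avoids3_inverse_imp:
  assumes p: "p permutes {..<n}"
  shows "avoids3 n (inv p) [2,3,1] \<Longrightarrow> avoids3 n p [3,1,2]"
    and "avoids3 n (inv p) [3,1,2] \<Longrightarrow> avoids3 n p [2,3,1]"
    and "avoids3 n (inv p) [1,2,3] \<Longrightarrow> avoids3 n p [1,2,3]"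
    and "avoids3 n (inv p) [1,3,2] \<Longrightarrow> avoids3 n p [1,3,2]"
    and "avoids3 n (inv p) [2,1,3] \<Longrightarrow> avoids3 n p [2,1,3]"
proof -
  note [simp] = permutes_inverses[OF p]
  show "avoids3 n p [3,1,2]" if *: "avoids3 n (inv p) [2,3,1]"
    unfolding avoids3_def order_isomorphic_3
  proof (intro allI impI notI)
    fix i j k assume "i < j" "j < k" "k < n" "p j < p k \<and> p k < p i"
    then show False
      using *[unfolded avoids3_def order_isomorphic_3, rule_format, of "p j" "p k" "p i"]
        permutes_lessD[OF p, of i] permutes_lessD[OF p, of j] permutes_lessD[OF p, of k]
      by simp
  qed
  show "avoids3 n p [2,3,1]" if *: "avoids3 n (inv p) [3,1,2]"
    unfolding avoids3_def order_isomorphic_3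
  proof (intro allI impI notI)
    fix i j k assume "i < j" "j < k" "k < n" "p k < p i \<and> p i < p j"
    then show False
      using *[unfolded avoids3_def order_isomorphic_3, rule_format, of "p k" "p i" "p j"]
        permutes_lessD[OF p, of i] permutes_lessD[OF p, of j] permutes_lessD[OF p, of k]
      by simp
  qed
  show "avoids3 n p [1,2,3]" if *: "avoids3 n (inv p) [1,2,3]"
    unfolding avoids3_def order_isomorphic_3
  proof (intro allI impI notI)
    fix i j k assume "i < j" "j < k" "k < n" "p i < p j \<and> p j < p k"
    then show False
      using *[unfolded avoids3_def order_isomorphic_3, rule_format, of "p i" "p j" "p k"]
        permutes_lessD[OF p, of i] permutes_lessD[OF p, of j] permutes_lessD[OF p, of k]
      by simp
  qed
  show "avoids3 n p [1,3,2]" if *: "avoids3 n (inv p) [1,3,2]"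
    unfolding avoids3_def order_isomorphic_3
  proof (intro allI impI notI)
    fix i j k assume "i < j" "j < k" "k < n" "p i < p k \<and> p k < p j"
    then show False
      using *[unfolded avoids3_def order_isomorphic_3, rule_format, of "p i" "p k" "p j"]
        permutes_lessD[OF p, of i] permutes_lessD[OF p, of j] permutes_lessD[OF p, of k]
      by simp
  qed
  show "avoids3 n p [2,1,3]" if *: "avoids3 n (inv p) [2,1,3]"
    unfolding avoids3_def order_isomorphic_3
  proof (intro allI impI notI)
    fix i j k assume "i < j" "j < k" "k < n" "p j < p i \<and> p i < p k"
    then show False
      using *[unfolded avoids3_def order_isomorphic_3, rule_format, of "p j" "p i" "p k"]
        permutes_lessD[OF p, of i] permutes_lessD[OF p, of j] permutes_lessD[OF p, of k]
      by simp
  qed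
qed

lemma avoids3_inverse_iff:
  assumes p: "p permutes {..<n}"
  shows "avoids3 n (inv p) [2,3,1] \<longleftrightarrow> avoids3 n p [3,1,2]"
    and "avoids3 n (inv p) [1,2,3] \<longleftrightarrow> avoids3 n p [1,2,3]"
    and "avoids3 n (inv p) [1,3,2] \<longleftrightarrow> avoids3 n p [1,3,2]"
    and "avoids3 n (inv p) [2,1,3] \<longleftrightarrow> avoids3 n p [2,1,3]"
  using avoids3_inverse_imp[OF p] avoids3_inverse_imp[OF permutes_inv[OF p]]
  unfolding permutes_inv_inv[OF p] by blast+

text \<open>A pair \<open>(i, j)\<close> of positions corresponds to the pair \<open>(p i, p j)\<close> of positions of the inverse. Since
  both kinds of crossings are non-inversions, the order of the pair is kept.\<close>

lemma card_crosses_inverse: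
  assumes p: "p permutes {..<n}"
  shows "card (crosses n (inv p)) = card (dual_crosses n p)"
proof (rule sym, rule bij_betw_same_card)
  note [simp] = permutes_inverses[OF p] permutes_lessD[OF p]
    permutes_lessD[OF permutes_inv[OF p]]
  show "bij_betw (map_prod p p) (dual_crosses n p) (crosses n (inv p))"
    by (rule bij_betw_byWitness[where f' = "map_prod (inv p) (inv p)"])
       (auto simp: crosses_def dual_crosses_def)
qed

lemma series_dual_crosses_av_perms:
  assumes "\<And>n p. p permutes {..<n} \<Longrightarrow> (\<forall>\<tau>\<in>T'. avoids3 n (inv p) \<tau>) \<longleftrightarrow> (\<forall>\<tau>\<in>T. avoids3 n p \<tau>)"
  shows "series dual_crosses (av_perms T) = series crosses (av_perms T')"
proof -
  have "bij_betw inv (av_perms T n) (av_perms T' n)" for n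
  proof (rule bij_betw_byWitness[where f' = inv])
    show "inv ` av_perms T n \<subseteq> av_perms T' n" using assms by (auto simp: av_perms_def permutes_inv)
    show "inv ` av_perms T' n \<subseteq> av_perms T n"
      using assms[OF permutes_inv] by (auto simp: av_perms_def permutes_inv permutes_inv_inv)
  qed (auto simp: av_perms_def permutes_inv_inv)
  then have "(\<Sum>p\<in>av_perms T n. monom 1 (card (crosses n (inv p))))
      = (\<Sum>p\<in>av_perms T' n. monom (1::int) (card (crosses n p)))" for n
    by (rule sum.reindex_bij_betw)
  moreover have "(\<Sum>p\<in>av_perms T n. monom 1 (card (crosses n (inv p))))
      = (\<Sum>p\<in>av_perms T n. monom (1::int) (card (dual_crosses n p)))" for n
    by (rule sum.cong) (auto simp: av_perms_def card_crosses_inverse)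
  ultimately show ?thesis by (simp add: series_def)
qed

definition reversal :: "nat \<Rightarrow> nat \<Rightarrow> nat" where
  "reversal n i = (if i < n then n - Suc i else i)"

lemma reversal_reversal [simp]: "reversal n (reversal n i) = i"
  by (auto simp: reversal_def)

lemma reversal_permutes: "reversal n permutes {..<n}"
  by (rule inj_imp_permutes) (auto simp: reversal_def inj_on_def)

text \<open>The inverse of the reverse complement, that is, the reflection of the permutation matrix in its
  antidiagonal.\<close>

definition inv_rev_compl :: "nat \<Rightarrow> (nat \<Rightarrow> nat) \<Rightarrow> nat \<Rightarrow> nat" where
  "inv_rev_compl n p = reversal n \<circ> inv p \<circ> reversal n"

lemma inv_rev_compl_permutes: "p permutes {..<n} \<Longrightarrow> inv_rev_compl n p permutes {..<n}"
  unfolding inv_rev_compl_def by (intro permutes_compose reversal_permutes permutes_inv)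

lemma inv_rev_compl_involution:
  assumes p: "p permutes {..<n}"
  shows "inv_rev_compl n (inv_rev_compl n p) = p"
proof -
  have "inv (inv_rev_compl n p) = reversal n \<circ> p \<circ> reversal n"
    unfolding inv_rev_compl_def
    by (rule inv_unique_comp) (auto simp: fun_eq_iff permutes_inverses[OF p])
  then show ?thesis by (subst inv_rev_compl_def) (simp add: fun_eq_iff)
qed

text \<open>The point \<open>(i, p i)\<close> of the graph is reflected to \<open>(n - 1 - p i, n - 1 - i)\<close>.\<close>

lemma inv_rev_compl_at:
  assumes p: "p permutes {..<n}" and "i < n"
  shows "inv_rev_compl n p (n - Suc (p i)) = n - Suc i"
proof -
  have "n - Suc (p i) = reversal n (p i)" using permutes_lessD[OF assms] by (simp add: reversal_def)
  then have "inv_rev_compl n p (n - Suc (p i)) = reversal n i"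
    by (simp add: inv_rev_compl_def permutes_inverses[OF p])
  then show ?thesis using \<open>i < n\<close> by (simp add: reversal_def)
qed

lemma avoids3_inv_rev_compl_imp:
  assumes p: "p permutes {..<n}"
  shows "avoids3 n (inv_rev_compl n p) [2,3,1] \<Longrightarrow> avoids3 n p [2,3,1]"
    and "avoids3 n (inv_rev_compl n p) [1,3,2] \<Longrightarrow> avoids3 n p [2,1,3]"
    and "avoids3 n (inv_rev_compl n p) [2,1,3] \<Longrightarrow> avoids3 n p [1,3,2]"
proof -
  note [simp] = inv_rev_compl_at[OF p]
  show "avoids3 n p [2,3,1]" if *: "avoids3 n (inv_rev_compl n p) [2,3,1]"
    unfolding avoids3_def order_isomorphic_3
  proof (intro allI impI notI)
    fix i j k assume "i < j" "j < k" "k < n" "p k < p i \<and> p i < p j"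
    then show False
      using *[unfolded avoids3_def order_isomorphic_3, rule_format,
        of "n - Suc (p j)" "n - Suc (p i)" "n - Suc (p k)"]
      permutes_lessD[OF p, of i] permutes_lessD[OF p, of j] permutes_lessD[OF p, of k]
      by (simp add: diff_less_mono2)
  qed
  show "avoids3 n p [2,1,3]" if *: "avoids3 n (inv_rev_compl n p) [1,3,2]"
    unfolding avoids3_def order_isomorphic_3
  proof (intro allI impI notI)
    fix i j k assume "i < j" "j < k" "k < n" "p j < p i \<and> p i < p k"
    then show False
      using *[unfolded avoids3_def order_isomorphic_3, rule_format,
        of "n - Suc (p k)" "n - Suc (p i)" "n - Suc (p j)"]
      permutes_lessD[OF p, of i] permutes_lessD[OF p, of j] permutes_lessD[OF p, of k]
      by (simp add: diff_less_mono2)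
  qed
  show "avoids3 n p [1,3,2]" if *: "avoids3 n (inv_rev_compl n p) [2,1,3]"
    unfolding avoids3_def order_isomorphic_3
  proof (intro allI impI notI)
    fix i j k assume "i < j" "j < k" "k < n" "p i < p k \<and> p k < p j"
    then show False
      using *[unfolded avoids3_def order_isomorphic_3, rule_format,
        of "n - Suc (p j)" "n - Suc (p k)" "n - Suc (p i)"]
      permutes_lessD[OF p, of i] permutes_lessD[OF p, of j] permutes_lessD[OF p, of k]
      by (simp add: diff_less_mono2)
  qed
qed

text \<open>The reflection sends the points at \<open>i < j\<close> to points in the opposite order, and then \<open>j < p i\<close>
  reads \<open>n - 1 - p i < n - 1 - j\<close>: strictness is kept, and crossings become crossings. As the
  reflection is an involution, one inequality is enough.\<close>

lemma card_crosses_inv_rev_compl_le: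
  assumes p: "p permutes {..<n}"
  shows "card (crosses n p) \<le> card (crosses n (inv_rev_compl n p))"
proof (rule card_inj_on_le)
  let ?f = "\<lambda>(i, j). (n - Suc (p j), n - Suc (p i))"
  show "inj_on ?f (crosses n p)"
  proof (rule inj_onI, clarify)
    fix i j i' j'
    assume "(i, j) \<in> crosses n p" "(i', j') \<in> crosses n p"
      and eq: "n - Suc (p j) = n - Suc (p j')" "n - Suc (p i) = n - Suc (p i')"
    then have "i < n" "j < n" "i' < n" "j' < n" by (auto simp: crosses_def)
    then have "p i < n" "p j < n" "p i' < n" "p j' < n" by (auto simp: permutes_lessD[OF p])
    with eq have "p i = p i'" "p j = p j'" by auto
    then show "i = i' \<and> j = j'" using permutes_less_eqD[OF p] by blast
  qed
  show "?f ` crosses n p \<subseteq> crosses n (inv_rev_compl n p)"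
  proof clarify
    fix i j assume "(i, j) \<in> crosses n p"
    then have *: "i < j" "j < n" "p i < p j" "j < p i \<or> p j \<le> i" by (auto simp: crosses_def)
    moreover have "p i < n" "p j < n" using * by (auto simp: permutes_lessD[OF p])
    ultimately show "(n - Suc (p j), n - Suc (p i)) \<in> crosses n (inv_rev_compl n p)"
      by (auto simp: crosses_def inv_rev_compl_at[OF p])
  qed
qed (rule finite_crosses)

lemma card_crosses_inv_rev_compl:
  "p permutes {..<n} \<Longrightarrow> card (crosses n (inv_rev_compl n p)) = card (crosses n p)"
  using card_crosses_inv_rev_compl_le[of p n]
    card_crosses_inv_rev_compl_le[OF inv_rev_compl_permutes, of p n]
  by (simp add: inv_rev_compl_involution)

lemma series_231_132_eq_231_213:
  "series crosses (av_perms {[2,3,1], [1,3,2]}) = series crosses (av_perms {[2,3,1], [2,1,3]})"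
proof -
  have "bij_betw (inv_rev_compl n) (av_perms {[2,3,1], [1,3,2]} n) (av_perms {[2,3,1], [2,1,3]} n)" for n
  proof (rule bij_betw_byWitness[where f' = "inv_rev_compl n"])
    show "inv_rev_compl n ` av_perms {[2,3,1], [1,3,2]} n \<subseteq> av_perms {[2,3,1], [2,1,3]} n"
      using avoids3_inv_rev_compl_imp[OF inv_rev_compl_permutes]
      by (auto simp: av_perms_def inv_rev_compl_permutes inv_rev_compl_involution)
    show "inv_rev_compl n ` av_perms {[2,3,1], [2,1,3]} n \<subseteq> av_perms {[2,3,1], [1,3,2]} n"
      using avoids3_inv_rev_compl_imp[OF inv_rev_compl_permutes]
      by (auto simp: av_perms_def inv_rev_compl_permutes inv_rev_compl_involution)
  qed (auto simp: av_perms_def inv_rev_compl_involution)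
  then have "(\<Sum>p\<in>av_perms {[2,3,1], [1,3,2]} n. monom 1 (card (crosses n (inv_rev_compl n p))))
      = (\<Sum>p\<in>av_perms {[2,3,1], [2,1,3]} n. monom (1::int) (card (crosses n p)))" for n
    by (rule sum.reindex_bij_betw)
  moreover have "(\<Sum>p\<in>av_perms {[2,3,1], [1,3,2]} n. monom 1 (card (crosses n (inv_rev_compl n p))))
      = (\<Sum>p\<in>av_perms {[2,3,1], [1,3,2]} n. monom (1::int) (card (crosses n p)))" for n
    by (rule sum.cong) (auto simp: av_perms_def card_crosses_inv_rev_compl)
  ultimately show ?thesis by (simp add: series_def)
qed

section \<open>Cutting a 312-avoider at its minimum\<close>

text \<open>The permutation \<open>(A 1) \<oplus> B\<close>, with \<open>A\<close> of size \<open>k\<close> and the minimum at position \<open>k\<close>.\<close>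

definition glue :: "nat \<Rightarrow> (nat \<Rightarrow> nat) \<Rightarrow> (nat \<Rightarrow> nat) \<Rightarrow> nat \<Rightarrow> nat" where
  "glue k A B i = (if i < k then Suc (A i) else if i = k then 0 else Suc (k + B (i - Suc k)))"

lemma glue_simps [simp]:
  "i < k \<Longrightarrow> glue k A B i = Suc (A i)"
  "glue k A B k = 0"
  "glue k A B (Suc (k + i)) = Suc (k + B i)"
  by (simp_all add: glue_def)

lemma glue_index_cases:
  assumes "i < Suc (k + m)"
  obtains "i < k" | "i = k" | i' where "i = Suc (k + i')" "i' < m"
  using assms less_imp_Suc_add[of k i] by (metis add_less_cancel_left linorder_neqE_nat Suc_less_eq)

lemma glue_permutes:
  assumes A: "A permutes {..<k}" and B: "B permutes {..<m}"
  shows "glue k A B permutes {..<Suc (k + m)}"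
proof (rule inj_imp_permutes)
  show "inj_on (glue k A B) {..<Suc (k + m)}"
  proof (rule inj_onI)
    fix i j assume "i \<in> {..<Suc (k + m)}" "j \<in> {..<Suc (k + m)}" "glue k A B i = glue k A B j"
    then show "i = j"
      using permutes_lessD[OF A, of i] permutes_lessD[OF A, of j]
      by (auto elim!: glue_index_cases dest: permutes_less_eqD[OF A] permutes_less_eqD[OF B])
  qed
  show "glue k A B i \<in> {..<Suc (k + m)}" if "i \<in> {..<Suc (k + m)}" for i
    using that
    by (auto elim!: glue_index_cases
        simp: trans_less_add1 permutes_lessD[OF A] permutes_lessD[OF B])
  show "glue k A B i = i" if "i \<notin> {..<Suc (k + m)}" for i
    using that permutes_not_in[OF B, of "i - Suc k"] by (auto simp: glue_def)
qed simp

lemma glue_inj: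
  assumes A: "A permutes {..<k}" and A': "A' permutes {..<k'}"
    and eq: "glue k A B = glue k' A' B'"
  shows "k = k' \<and> A = A' \<and> B = B'"
proof -
  have "glue k A B i = 0 \<longleftrightarrow> i = k" for i by (auto simp: glue_def)
  moreover have "glue k' A' B' i = 0 \<longleftrightarrow> i = k'" for i by (auto simp: glue_def)
  ultimately have [simp]: "k' = k" using eq by metis
  have "A i = A' i" for i
    using fun_cong[OF eq, of i] permutes_not_in[OF A, of i] permutes_not_in[OF A', of i]
    by (cases "i < k") auto
  moreover have "B i = B' i" for i using fun_cong[OF eq, of "Suc (k + i)"] by simp
  ultimately show ?thesis by auto
qed

text \<open>For \<open>i, j < k\<close> the condition \<open>j < Suc (A i)\<close> is \<open>j \<le> A i\<close>, and \<open>Suc (A j) \<le> i\<close> is \<open>A j < i\<close>;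
  this is where the dual crossings come from.\<close>

lemma card_crosses_glue:
  assumes A: "A permutes {..<k}" and B: "B permutes {..<m}"
  shows "card (crosses (Suc (k + m)) (glue k A B)) = card (dual_crosses k A) + card (crosses m B)"
proof -
  let ?s = "\<lambda>i. Suc (k + i)"
  have "crosses (Suc (k + m)) (glue k A B) = dual_crosses k A \<union> map_prod ?s ?s ` crosses m B" (is "?L = ?R")
  proof (rule set_eqI, clarify)
    fix i j
    show "(i, j) \<in> ?L \<longleftrightarrow> (i, j) \<in> ?R"
    proof (cases "i < j \<and> j < Suc (k + m)")
      case True
      then have "i < j" "i < Suc (k + m)" "j < Suc (k + m)" by auto
      then show ?thesis
        using permutes_lessD[OF A, of i] permutes_lessD[OF A, of j]
        by (elim glue_index_cases[of i] glue_index_cases[of j])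
           (auto simp: crosses_def dual_crosses_def image_iff)
    qed (auto simp: crosses_def dual_crosses_def)
  qed
  moreover have "dual_crosses k A \<inter> map_prod ?s ?s ` crosses m B = {}" by (auto simp: dual_crosses_def)
  moreover have "card (map_prod ?s ?s ` crosses m B) = card (crosses m B)"
    by (rule card_image) (auto simp: inj_on_def)
  ultimately show ?thesis by (simp add: card_Un_disjoint finite_crosses)
qed

text \<open>A property of three entries is checked separately for each distribution of their positions among
  \<open>A\<close>, the minimum and \<open>B\<close>.\<close>

lemma glue_triples:
  "(\<forall>i j l. i < j \<longrightarrow> j < l \<longrightarrow> l < Suc (k + m) \<longrightarrow> P (glue k A B i) (glue k A B j) (glue k A B l)) \<longleftrightarrow>
    (\<forall>i j l. i < j \<longrightarrow> j < l \<longrightarrow> l < k \<longrightarrow> P (Suc (A i)) (Suc (A j)) (Suc (A l))) \<and>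
    (\<forall>i j. i < j \<longrightarrow> j < k \<longrightarrow> P (Suc (A i)) (Suc (A j)) 0) \<and>
    (\<forall>i j l. i < j \<longrightarrow> j < k \<longrightarrow> l < m \<longrightarrow> P (Suc (A i)) (Suc (A j)) (Suc (k + B l))) \<and>
    (\<forall>i l. i < k \<longrightarrow> l < m \<longrightarrow> P (Suc (A i)) 0 (Suc (k + B l))) \<and>
    (\<forall>i j l. i < k \<longrightarrow> j < l \<longrightarrow> l < m \<longrightarrow> P (Suc (A i)) (Suc (k + B j)) (Suc (k + B l))) \<and>
    (\<forall>j l. j < l \<longrightarrow> l < m \<longrightarrow> P 0 (Suc (k + B j)) (Suc (k + B l))) \<and>
    (\<forall>i j l. i < j \<longrightarrow> j < l \<longrightarrow> l < m \<longrightarrow> P (Suc (k + B i)) (Suc (k + B j)) (Suc (k + B l)))"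
  (is "?L \<longleftrightarrow> ?R")
proof
  assume L: ?L
  let ?s = "\<lambda>i. Suc (k + i)"
  show ?R
  proof (intro conjI allI impI)
    fix i j l assume "i < j" "j < l" "l < k"
    then show "P (Suc (A i)) (Suc (A j)) (Suc (A l))" using L[rule_format, of i j l] by simp
  next
    fix i j assume "i < j" "j < k"
    then show "P (Suc (A i)) (Suc (A j)) 0" using L[rule_format, of i j k] by simp
  next
    fix i j l assume "i < j" "j < k" "l < m"
    then show "P (Suc (A i)) (Suc (A j)) (Suc (k + B l))" using L[rule_format, of i j "?s l"] by simp
  next
    fix i l assume "i < k" "l < m"
    then show "P (Suc (A i)) 0 (Suc (k + B l))" using L[rule_format, of i k "?s l"] by simp
  next
    fix i j l assume "i < k" "j < l" "l < m"
    then show "P (Suc (A i)) (Suc (k + B j)) (Suc (k + B l))"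
      using L[rule_format, of i "?s j" "?s l"] by simp
  next
    fix j l assume "j < l" "l < m"
    then show "P 0 (Suc (k + B j)) (Suc (k + B l))"
      using L[rule_format, of k "?s j" "?s l"] by simp
  next
    fix i j l assume "i < j" "j < l" "l < m"
    then show "P (Suc (k + B i)) (Suc (k + B j)) (Suc (k + B l))"
      using L[rule_format, of "?s i" "?s j" "?s l"] by simp
  qed
next
  assume R: ?R
  show ?L
  proof (intro allI impI)
    fix i j l assume *: "i < j" "j < l" "l < Suc (k + m)"
    then have "j < Suc (k + m)" "i < Suc (k + m)" by auto
    then show "P (glue k A B i) (glue k A B j) (glue k A B l)"
      using *
      by (elim glue_index_cases[of i] glue_index_cases[of j] glue_index_cases[of l])
         (simp_all add: R[THEN conjunct1, rule_format]
           R[THEN conjunct2, THEN conjunct1, rule_format]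
           R[THEN conjunct2, THEN conjunct2, THEN conjunct1, rule_format]
           R[THEN conjunct2, THEN conjunct2, THEN conjunct2, THEN conjunct1, rule_format]
           R[THEN conjunct2, THEN conjunct2, THEN conjunct2, THEN conjunct2, THEN conjunct1, rule_format]
           R[THEN conjunct2, THEN conjunct2, THEN conjunct2, THEN conjunct2, THEN conjunct2, THEN conjunct1, rule_format]
           R[THEN conjunct2, THEN conjunct2, THEN conjunct2, THEN conjunct2, THEN conjunct2, THEN conjunct2, rule_format])
  qed
qed

text \<open>The minimum at the end of \<open>A 1\<close> cannot complete a pattern inside \<open>A 1\<close>, since none of the four
  patterns ends in its 1. An occurrence of 312 cannot meet both summands, since its first entry
  exceeds the two others. For the other patterns, an entry of \<open>A 1\<close> can serve as the 1 in front of
  \<open>B\<close>, which excludes inversions in \<open>B\<close> for 132 and non-inversions for 123, and an entry of \<open>B\<close> can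
  serve as the 3 behind \<open>A 1\<close>, which excludes inversions in \<open>A 1\<close> for 213 and non-inversions in \<open>A\<close>
  for 123. In particular \<open>A\<close> is then empty for 213, as \<open>A 1\<close> ends with its minimum.\<close>

lemma avoids3_glue:
  assumes A: "A permutes {..<k}" and B: "B permutes {..<m}"
  shows "avoids3 (Suc (k + m)) (glue k A B) [3,1,2] \<longleftrightarrow> avoids3 k A [3,1,2] \<and> avoids3 m B [3,1,2]"
    and "avoids3 (Suc (k + m)) (glue k A B) [1,3,2] \<longleftrightarrow>
      avoids3 k A [1,3,2] \<and> (\<forall>i j. i < j \<longrightarrow> j < m \<longrightarrow> B i \<le> B j)"
    and "avoids3 (Suc (k + m)) (glue k A B) [2,1,3] \<longleftrightarrow>
      avoids3 k A [2,1,3] \<and> avoids3 m B [2,1,3] \<and> (k = 0 \<or> m = 0)"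
    and "avoids3 (Suc (k + m)) (glue k A B) [1,2,3] \<longleftrightarrow>
      avoids3 k A [1,2,3] \<and> (\<forall>i j. i < j \<longrightarrow> j < m \<longrightarrow> B j \<le> B i) \<and>
      (m = 0 \<or> (\<forall>i j. i < j \<longrightarrow> j < k \<longrightarrow> A j \<le> A i))"
proof -
  have [simp]: "A i < k + x" "\<not> k + x < A i" if "i < k" for i x
    using permutes_lessD[OF A that] by auto
  show "avoids3 (Suc (k + m)) (glue k A B) [3,1,2] \<longleftrightarrow> avoids3 k A [3,1,2] \<and> avoids3 m B [3,1,2]"
    unfolding avoids3_def order_isomorphic_3
      glue_triples[where P = "\<lambda>a b c. \<not> (b < c \<and> c < a)"]
    by simp
  show "avoids3 (Suc (k + m)) (glue k A B) [1,3,2] \<longleftrightarrow>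
      avoids3 k A [1,3,2] \<and> (\<forall>i j. i < j \<longrightarrow> j < m \<longrightarrow> B i \<le> B j)"
    unfolding avoids3_def order_isomorphic_3
      glue_triples[where P = "\<lambda>a b c. \<not> (a < c \<and> c < b)"]
    by (simp add: not_less) (meson not_less less_trans)
  show "avoids3 (Suc (k + m)) (glue k A B) [2,1,3] \<longleftrightarrow>
      avoids3 k A [2,1,3] \<and> avoids3 m B [2,1,3] \<and> (k = 0 \<or> m = 0)"
    unfolding avoids3_def order_isomorphic_3
      glue_triples[where P = "\<lambda>a b c. \<not> (b < a \<and> a < c)"]
    by auto
  show "avoids3 (Suc (k + m)) (glue k A B) [1,2,3] \<longleftrightarrow>
      avoids3 k A [1,2,3] \<and> (\<forall>i j. i < j \<longrightarrow> j < m \<longrightarrow> B j \<le> B i) \<and>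
      (m = 0 \<or> (\<forall>i j. i < j \<longrightarrow> j < k \<longrightarrow> A j \<le> A i))"
    unfolding avoids3_def order_isomorphic_3
      glue_triples[where P = "\<lambda>a b c. \<not> (a < b \<and> b < c)"]
    by (cases "m = 0") (auto simp: not_less, blast)
qed

lemma avoids3_0 [simp]: "avoids3 0 p \<tau>"
  by (simp add: avoids3_def)

text \<open>The case of an empty \<open>B\<close>, the identity being the only permutation of size 0.\<close>

lemma glue_id_in_av_perms:
  assumes "T \<subseteq> {[3,1,2], [1,2,3], [1,3,2], [2,1,3]}" and A: "A permutes {..<k}"
  shows "glue k A id \<in> av_perms T (Suc k) \<longleftrightarrow> A \<in> av_perms T k"
proof -
  have id: "id permutes {..<0::nat}" by simp
  have "avoids3 (Suc k) (glue k A id) \<tau> \<longleftrightarrow> avoids3 k A \<tau>" if "\<tau> \<in> T" for \<tau>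
  proof -
    have "\<tau> = [3,1,2] \<or> \<tau> = [1,2,3] \<or> \<tau> = [1,3,2] \<or> \<tau> = [2,1,3]" using assms(1) that by blast
    then show ?thesis
      by (elim disjE; hypsubst) (use avoids3_glue[OF A id] in simp_all)
  qed
  then show ?thesis using A glue_permutes[OF A id] by (simp add: av_perms_def)
qed

text \<open>Every 312-avoider arises by gluing: all values up to and including position \<open>k\<close> of the minimum are
  smaller than all later ones, hence they are exactly the values \<open>0, \<dots>, k\<close>.\<close>

lemma glue_surj:
  assumes p: "p permutes {..<Suc n}" and avoid312: "avoids3 (Suc n) p [3,1,2]"
  obtains k A B where "k \<le> n" "A permutes {..<k}" "B permutes {..<n - k}" "p = glue k A B"
proof -
  define k where "k = inv p 0"
  have pk: "p k = 0" by (simp add: k_def permutes_inverses[OF p])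
  have kn: "k \<le> n" using permutes_lessD[OF permutes_inv[OF p], of 0] by (simp add: k_def)
  have p0: "p i > 0" if "i \<noteq> k" for i using permutes_less_eqD[OF p, of i k] pk that by auto
  have less: "p i < p j" if "i \<le> k" "k < j" for i j
  proof (cases "i = k \<or> j > n")
    case True
    then show ?thesis
    proof
      assume "j > n"
      then show ?thesis using permutes_lessD[OF p, of i] permutes_not_in[OF p, of j] that kn by simp
    qed (use p0[of j] pk that in simp)
  next
    case False
    then have "\<not> (p k < p j \<and> p j < p i)"
      using avoid312 that kn unfolding avoids3_def order_isomorphic_3
      by (metis le_neq_implies_less less_Suc_eq_le not_less)
    then show ?thesis
      using p0[of j] pk that permutes_less_eqD[OF p, of i j]
      by (cases "p i" "p j" rule: linorder_cases) auto
  qed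
  \<comment> \<open>The values at positions up to \<open>k\<close> form a downward closed set with \<open>k + 1\<close> elements.\<close>
  have low: "p i \<le> k" if "i \<le> k" for i
  proof -
    have "{..p i} \<subseteq> p ` {..k}"
    proof
      fix v assume "v \<in> {..p i}"
      then have "p (inv p v) \<le> p i" by (simp add: permutes_inverses[OF p])
      then have "inv p v \<le> k" using less[OF that, of "inv p v"] by (meson not_le)
      then show "v \<in> p ` {..k}" by (metis atMost_iff imageI permutes_inverses(1)[OF p])
    qed
    then have "card {..p i} \<le> card (p ` {..k})" by (rule card_mono[rotated]) simp
    also have "\<dots> \<le> card {..k}" by (rule card_image_le) simp
    finally show ?thesis by simp
  qed
  have "card (p ` {..k}) = card {..k}"
    by (rule card_image[OF inj_on_subset[OF permutes_inj[OF p]]]) simp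
  then have "p ` {..k} = {..k}"
    using low by (intro card_subset_eq) auto
  then have high: "k < p j" if "k < j" for j
    using that permutes_less_eqD[OF p, of _ j] by (metis atMost_iff imageE not_le)
  define A where "A = (\<lambda>i. if i < k then p i - 1 else i)"
  define B where "B = (\<lambda>i. p (Suc (k + i)) - Suc k)"
  have "A permutes {..<k}"
  proof (rule inj_imp_permutes)
    show "inj_on A {..<k}"
    proof (rule inj_onI)
      fix i j assume "i \<in> {..<k}" "j \<in> {..<k}" "A i = A j"
      then have "p i = p j" using p0[of i] p0[of j] by (simp add: A_def)
      then show "i = j" by (rule permutes_less_eqD[OF p])
    qed
    show "A i \<in> {..<k}" if "i \<in> {..<k}" for i
      using that p0[of i] low[of i] by (simp add: A_def)
  qed (auto simp: A_def)
  moreover have "B permutes {..<n - k}"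
  proof (rule inj_imp_permutes)
    show "inj_on B {..<n - k}"
    proof (rule inj_onI)
      fix i j assume "B i = B j"
      then have "p (Suc (k + i)) = p (Suc (k + j))"
        using high[of "Suc (k + i)"] high[of "Suc (k + j)"] by (simp add: B_def)
      then show "i = j" using permutes_less_eqD[OF p] by fastforce
    qed
    show "B i \<in> {..<n - k}" if "i \<in> {..<n - k}" for i
      using that permutes_lessD[OF p, of "Suc (k + i)"] high[of "Suc (k + i)"]
      by (simp add: B_def less_diff_conv)
    show "B i = i" if "i \<notin> {..<n - k}" for i
      using that permutes_not_in[OF p, of "Suc (k + i)"] kn by (simp add: B_def)
  qed simp
  moreover have "p = glue k A B"
  proof
    fix i
    show "p i = glue k A B i"
    proof (cases i k rule: linorder_cases)
      case less then show ?thesis using p0[of i] by (simp add: A_def)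
    next
      case greater then show ?thesis using high[of i] by (simp add: glue_def B_def)
    qed (use pk in simp)
  qed
  ultimately show thesis using that kn by blast
qed

section \<open>The functional equation\<close>

text \<open>The second summand collects the permutations ending with their minimum, the third those in which
  \<open>B\<close> is nonempty. In the third, the avoidance condition has to factor into one on \<open>A\<close> and one on \<open>B\<close>;
  \<open>Y 0 = {}\<close> expresses that \<open>B\<close> is nonempty there.\<close>

lemma glue_functional_equation:
  assumes T: "[3,1,2] \<in> T" "T \<subseteq> {[3,1,2], [1,2,3], [1,3,2], [2,1,3]}"
    and X: "\<And>k. X k \<subseteq> {p. p permutes {..<k}}"
    and Y: "\<And>m. Y m \<subseteq> {p. p permutes {..<m}}" "Y 0 = {}"
    and split: "\<And>k m A B. A permutes {..<k} \<Longrightarrow> B permutes {..<m} \<Longrightarrow> m > 0 \<Longrightarrow>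
      glue k A B \<in> av_perms T (Suc (k + m)) \<longleftrightarrow> A \<in> X k \<and> B \<in> Y m"
  shows "series crosses (av_perms T) = 1 + fps_X * series dual_crosses (av_perms T) +
    fps_X * (series dual_crosses X * series crosses Y)"
proof (rule fps_ext)
  fix n
  show "fps_nth (series crosses (av_perms T)) n =
    fps_nth (1 + fps_X * series dual_crosses (av_perms T) +
      fps_X * (series dual_crosses X * series crosses Y)) n"
  proof (cases n)
    case 0
    have "av_perms T 0 = {id}" by (auto simp: av_perms_def avoids3_def)
    moreover have "crosses 0 id = {}" by (simp add: crosses_def)
    ultimately show ?thesis using 0 by (simp add: series_nth)
  next
    case (Suc N)
    \<comment> \<open>The pairs \<open>(A, B)\<close> with \<open>A\<close> of size \<open>k\<close> that glue to members of the class.\<close>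
    define Z where "Z = (\<lambda>k. if k = N then av_perms T k \<times> {id} else X k \<times> Y (N - k))"
    have Z: "A permutes {..<k} \<and> B permutes {..<N - k}" if "(A, B) \<in> Z k" for k A B
      using that X Y by (auto simp: Z_def av_perms_def permutes_id split: if_splits)
    have glue_Z: "glue k A B \<in> av_perms T (Suc N) \<longleftrightarrow> (A, B) \<in> Z k"
      if "A permutes {..<k}" "B permutes {..<N - k}" "k \<le> N" for k A B
      using that split[of A k B "N - k"] glue_id_in_av_perms[OF T(2), of A k] by (auto simp: Z_def)
    have "bij_betw (\<lambda>(k, A, B). glue k A B) (Sigma {..N} Z) (av_perms T (Suc N))"
    proof (rule bij_betwI')
      fix x y assume "x \<in> Sigma {..N} Z" "y \<in> Sigma {..N} Z"
      then show "(case x of (k, A, B) \<Rightarrow> glue k A B) = (case y of (k, A, B) \<Rightarrow> glue k A B)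
          \<longleftrightarrow> x = y"
        using Z by (auto dest!: glue_inj[rotated 2])
    next
      fix x assume "x \<in> Sigma {..N} Z"
      then show "(case x of (k, A, B) \<Rightarrow> glue k A B) \<in> av_perms T (Suc N)"
        using Z glue_Z by auto
    next
      fix p assume p: "p \<in> av_perms T (Suc N)"
      then obtain k A B where *: "k \<le> N" "A permutes {..<k}" "B permutes {..<N - k}" "p = glue k A B"
        using glue_surj[of p N] T(1) by (auto simp: av_perms_def)
      then have "(A, B) \<in> Z k" using glue_Z p by blast
      then show "\<exists>x\<in>Sigma {..N} Z. p = (case x of (k, A, B) \<Rightarrow> glue k A B)"
        using * by (intro bexI[of _ "(k, A, B)"]) auto
    qed
    then have "(\<Sum>x\<in>Sigma {..N} Z. monom 1 (card (crosses (Suc N) (case x of (k, A, B) \<Rightarrow> glue k A B))))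
      = (\<Sum>p\<in>av_perms T (Suc N). monom (1::int) (card (crosses (Suc N) p)))"
      by (rule sum.reindex_bij_betw)
    then have "fps_nth (series crosses (av_perms T)) n =
      (\<Sum>x\<in>Sigma {..N} Z. monom 1 (card (crosses (Suc N) (case x of (k, A, B) \<Rightarrow> glue k A B))))"
      using Suc by (simp add: series_nth)
    also have "\<dots> = (\<Sum>x\<in>Sigma {..N} Z. case x of (k, A, B) \<Rightarrow>
        monom 1 (card (dual_crosses k A)) * monom 1 (card (crosses (N - k) B)))"
    proof (rule sum.cong[OF refl])
      fix x assume "x \<in> Sigma {..N} Z"
      then obtain k A B where *: "x = (k, A, B)" "k \<le> N" "(A, B) \<in> Z k" by auto
      then show "monom 1 (card (crosses (Suc N) (case x of (k, A, B) \<Rightarrow> glue k A B))) =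
        (case x of (k, A, B) \<Rightarrow> monom (1::int) (card (dual_crosses k A)) * monom 1 (card (crosses (N - k) B)))"
        using card_crosses_glue[of A k B "N - k"] Z[of A B k] by (simp add: mult_monom)
    qed
    also have "\<dots> = (\<Sum>k\<le>N. \<Sum>(A, B)\<in>Z k.
        monom 1 (card (dual_crosses k A)) * monom 1 (card (crosses (N - k) B)))"
    proof -
      have "Z k \<subseteq> {p. p permutes {..<k}} \<times> {p. p permutes {..<N - k}}" for k
        by (auto dest: Z)
      then have "finite (Z k)" for k
        by (rule finite_subset) (simp add: finite_perms_less)
      then show ?thesis by (subst sum.Sigma) (auto simp: split_def)
    qed
    also have "\<dots> = (\<Sum>k\<le>N. (if k = N then fps_nth (series dual_crosses (av_perms T)) k else 0) +
        fps_nth (series dual_crosses X) k * fps_nth (series crosses Y) (N - k))"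
    proof (rule sum.cong[OF refl])
      fix k assume "k \<in> {..N}"
      show "(\<Sum>(A, B)\<in>Z k. monom 1 (card (dual_crosses k A)) * monom 1 (card (crosses (N - k) B))) =
        (if k = N then fps_nth (series dual_crosses (av_perms T)) k else 0) +
        fps_nth (series dual_crosses X) k * fps_nth (series crosses Y) (N - k)"
      proof (cases "k = N")
        case True
        have "crosses 0 id = {}" by (simp add: crosses_def)
        then show ?thesis using True Y
          by (simp add: Z_def series_nth sum.cartesian_product[symmetric])
      next
        case False
        then show ?thesis
          by (simp add: Z_def series_nth sum.cartesian_product[symmetric] sum_product)
      qed
    qed
    also have "\<dots> = fps_nth (series dual_crosses (av_perms T)) N +
        fps_nth (series dual_crosses X * series crosses Y) N"
      by (simp add: sum.distrib fps_mult_nth atLeast0AtMost)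
    finally show ?thesis using Suc by simp
  qed
qed

section \<open>Monotone permutations\<close>

text \<open>Outside \<open>{..<n}\<close> the function is the identity, so \<open>p\<close> and its inverse are strictly increasing on
  all natural numbers, whence \<open>i \<le> p i\<close> and \<open>p i \<le> i\<close>.\<close>

lemma increasing_permutes_eq_id:
  assumes p: "p permutes {..<n::nat}" and inc: "\<And>i j. i < j \<Longrightarrow> j < n \<Longrightarrow> p i \<le> p j"
  shows "p = id"
proof -
  have inc': "p i < p j" if "i < j" for i j
  proof (cases "j < n")
    case True
    then show ?thesis using inc[OF that True] permutes_less_eqD[OF p, of i j] that by force
  next
    case False
    then show ?thesis
      using that permutes_not_in[OF p, of j] permutes_not_in[OF p, of i] permutes_lessD[OF p, of i]
      by (cases "i < n") auto
  qed
  then have sm: "strict_mono p" by (rule strict_monoI)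
  have "strict_mono (inv p)"
  proof (rule strict_monoI)
    fix a b :: nat assume "a < b"
    then have "p (inv p a) < p (inv p b)" by (simp add: permutes_inverses[OF p])
    then show "inv p a < inv p b" using sm by (simp add: strict_mono_less)
  qed
  show ?thesis
  proof
    fix i
    have "p i \<le> inv p (p i)" by (rule strict_mono_imp_increasing[OF \<open>strict_mono (inv p)\<close>])
    then have "p i \<le> i" by (simp add: permutes_inverses[OF p])
    then show "p i = id i" using strict_mono_imp_increasing[OF sm, of i] by simp
  qed
qed

lemma increasing_iff_id:
  assumes "p permutes {..<n::nat}"
  shows "(\<forall>i j. i < j \<longrightarrow> j < n \<longrightarrow> p i \<le> p j) \<longleftrightarrow> p = id"
  using increasing_permutes_eq_id[OF assms] by auto

lemma decreasing_iff_reversal: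
  assumes p: "p permutes {..<n::nat}"
  shows "(\<forall>i j. i < j \<longrightarrow> j < n \<longrightarrow> p j \<le> p i) \<longleftrightarrow> p = reversal n"
proof
  assume dec: "\<forall>i j. i < j \<longrightarrow> j < n \<longrightarrow> p j \<le> p i"
  have "reversal n \<circ> p = id"
  proof (rule increasing_permutes_eq_id)
    show "reversal n \<circ> p permutes {..<n}" by (rule permutes_compose[OF p reversal_permutes])
    fix i j assume "i < j" "j < n"
    then show "(reversal n \<circ> p) i \<le> (reversal n \<circ> p) j"
      using dec[rule_format, of i j] permutes_lessD[OF p, of i] permutes_lessD[OF p, of j]
      by (simp add: reversal_def)
  qed
  then show "p = reversal n" by (metis comp_apply reversal_reversal id_apply ext)
qed (auto simp: reversal_def)

lemma avoids3_monotone: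
  "avoids3 n id [3,1,2]" "avoids3 n (reversal n) [3,1,2]" "avoids3 n (reversal n) [1,2,3]"
  unfolding avoids3_def order_isomorphic_3 by (auto simp: reversal_def)

lemma crosses_monotone:
  "crosses n id = {}" "crosses n (reversal n) = {}" "dual_crosses n (reversal n) = {}"
  by (auto simp: crosses_def dual_crosses_def reversal_def)

lemma series_monotone:
  assumes "\<And>n. C n (p n) = {}"
  shows "series C (\<lambda>n. {p n}) = fps_quot 1 (1 - fps_X)"
    and "series C (\<lambda>n. if n = 0 then {} else {p n}) = fps_quot fps_X (1 - fps_X)"
proof -
  have "series C (\<lambda>n. {p n}) * (1 - fps_X) = 1"
    by (rule fps_ext, rename_tac n, case_tac n)
       (simp_all add: series_nth assms algebra_simps)
  then show "series C (\<lambda>n. {p n}) = fps_quot 1 (1 - fps_X)" by (intro fps_quot_unique) simp_all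
  have "series C (\<lambda>n. if n = 0 then {} else {p n}) * (1 - fps_X) = fps_X"
    by (rule fps_ext, rename_tac n, case_tac n)
       (simp_all add: series_nth assms algebra_simps fps_X_nth)
  then show "series C (\<lambda>n. if n = 0 then {} else {p n}) = fps_quot fps_X (1 - fps_X)"
    by (intro fps_quot_unique) simp_all
qed

section \<open>The three identities\<close>

(* The literal 1 occurs in the patterns; rewriting it to Suc 0 would keep the facts about
   avoids3 from matching. *)
declare One_nat_def [simp del]

lemma dual_series_312:
  "series dual_crosses (av_perms {[3,1,2]}) = series crosses (av_perms {[2,3,1]})"
  by (rule series_dual_crosses_av_perms) (simp add: avoids3_inverse_iff)

lemma dual_series_312_pair:
  assumes "\<tau> \<in> {[1,2,3], [1,3,2], [2,1,3]}"
  shows "series dual_crosses (av_perms {[3,1,2], \<tau>}) = series crosses (av_perms {[2,3,1], \<tau>})"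
  by (rule series_dual_crosses_av_perms) (use assms in \<open>auto simp: avoids3_inverse_iff\<close>)

text \<open>The only permutation lost is the empty one, whose weight is 1.\<close>

lemma series_nonempty:
  "series crosses (\<lambda>m. if m = 0 then {} else av_perms T m) = series crosses (av_perms T) - 1"
proof -
  have "av_perms T 0 = {id}" by (auto simp: av_perms_def avoids3_def)
  then show ?thesis by (intro fps_ext) (auto simp: series_nth crosses_monotone)
qed

lemma equation_312:
  "series crosses (av_perms {[3,1,2]}) =
    1 + fps_X * series crosses (av_perms {[2,3,1]}) * series crosses (av_perms {[3,1,2]})"
proof -
  let ?A = "av_perms {[3,1,2]}" and ?Y = "\<lambda>m. if m = 0 then {} else av_perms {[3,1,2]} m"
  have "series crosses ?A = 1 + fps_X * series dual_crosses ?A +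
    fps_X * (series dual_crosses ?A * series crosses ?Y)"
    by (rule glue_functional_equation) (auto simp: av_perms_def avoids3_glue glue_permutes)
  then show ?thesis by (simp add: series_nonempty dual_series_312 algebra_simps)
qed

lemma equation_312_123:
  "series crosses (av_perms {[3,1,2], [1,2,3]}) =
    1 + fps_X * series crosses (av_perms {[2,3,1], [1,2,3]}) +
    fps_X * (fps_quot 1 (1 - fps_X) * fps_quot fps_X (1 - fps_X))"
proof -
  let ?A = "av_perms {[3,1,2], [1,2,3]}"
  have "series crosses ?A = 1 + fps_X * series dual_crosses ?A +
    fps_X * (series dual_crosses (\<lambda>k. {reversal k}) *
      series crosses (\<lambda>m. if m = 0 then {} else {reversal m}))"
  proof (rule glue_functional_equation)
    fix k m :: nat and A B assume "A permutes {..<k}" "B permutes {..<m}" "m > 0"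
    then show "glue k A B \<in> ?A (Suc (k + m)) \<longleftrightarrow>
        A \<in> {reversal k} \<and> B \<in> (if m = 0 then {} else {reversal m})"
      using decreasing_iff_reversal[of A k] decreasing_iff_reversal[of B m]
      by (auto simp: av_perms_def avoids3_glue glue_permutes avoids3_monotone)
  qed (auto simp: reversal_permutes)
  then show ?thesis
    using series_monotone[where p = reversal] by (simp add: dual_series_312_pair crosses_monotone)
qed

lemma equation_312_132:
  "series crosses (av_perms {[3,1,2], [1,3,2]}) =
    1 + fps_X * series crosses (av_perms {[2,3,1], [1,3,2]}) +
    fps_X * (series crosses (av_perms {[2,3,1], [1,3,2]}) * fps_quot fps_X (1 - fps_X))"
proof -
  let ?A = "av_perms {[3,1,2], [1,3,2]}"
  have "series crosses ?A = 1 + fps_X * series dual_crosses ?A +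
    fps_X * (series dual_crosses ?A * series crosses (\<lambda>m. if m = 0 then {} else {id}))"
  proof (rule glue_functional_equation)
    fix k m :: nat and A B assume "A permutes {..<k}" "B permutes {..<m}" "m > 0"
    then show "glue k A B \<in> ?A (Suc (k + m)) \<longleftrightarrow>
        A \<in> ?A k \<and> B \<in> (if m = 0 then {} else {id})"
      using increasing_iff_id[of B m]
      by (auto simp: av_perms_def avoids3_glue glue_permutes avoids3_monotone)
  qed (auto simp: av_perms_def permutes_id)
  then show ?thesis
    using series_monotone(2)[where p = "\<lambda>_. id"] by (simp add: dual_series_312_pair crosses_monotone)
qed

lemma equation_312_213:
  "series crosses (av_perms {[3,1,2], [2,1,3]}) =
    1 + fps_X * series crosses (av_perms {[2,3,1], [2,1,3]}) +
    fps_X * (series crosses (av_perms {[3,1,2], [2,1,3]}) - 1)"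
proof -
  let ?A = "av_perms {[3,1,2], [2,1,3]}"
  let ?X = "\<lambda>k. if k = 0 then {id} else {}"
  have "series crosses ?A = 1 + fps_X * series dual_crosses ?A +
    fps_X * (series dual_crosses ?X * series crosses (\<lambda>m. if m = 0 then {} else ?A m))"
  proof (rule glue_functional_equation)
    fix k m :: nat and A B assume A: "A permutes {..<k}" and B: "B permutes {..<m}" and "m > 0"
    then have "glue k A B \<in> ?A (Suc (k + m)) \<longleftrightarrow> A \<in> ?A k \<and> B \<in> ?A m \<and> k = 0"
      by (auto simp: av_perms_def avoids3_glue[OF A B] glue_permutes[OF A B])
    then show "glue k A B \<in> ?A (Suc (k + m)) \<longleftrightarrow>
        A \<in> ?X k \<and> B \<in> (if m = 0 then {} else ?A m)"
      using A \<open>m > 0\<close> by (auto simp: av_perms_def)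
  qed (auto simp: av_perms_def permutes_id)
  moreover have "series dual_crosses ?X = 1"
    by (intro fps_ext) (auto simp: series_nth dual_crosses_def)
  ultimately show ?thesis by (simp add: series_nonempty dual_series_312_pair)
qed

theorem theorem3:
  shows "F {[3,1,2]} = fps_quot 1 (1 - fps_X * F {[2,3,1]}) \<and>
    F {[3,1,2], [1,2,3]} =
      1 + (fps_quot fps_X (1 - fps_X))\<^sup>2 + fps_X * F {[2,3,1], [1,2,3]} \<and>
    (\<forall>(\<tau>, \<tau>') \<in> {[1,3,2], [2,1,3]} \<times> {[1,3,2], [2,1,3]}.
      F {[3,1,2], \<tau>} = 1 + fps_quot fps_X (1 - fps_X) * F {[2,3,1], \<tau>'})"
proof -
  let ?Q = "fps_quot fps_X (1 - fps_X) :: int poly fps"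
  have F: "F {[3,1,2]} = series crosses (av_perms {[3,1,2]})"
    "F {[2,3,1]} = series crosses (av_perms {[2,3,1]})"
    "\<tau> \<in> {[1,2,3], [1,3,2], [2,1,3]} \<Longrightarrow> F {[3,1,2], \<tau>} = series crosses (av_perms {[3,1,2], \<tau>})"
    "\<tau> \<in> {[1,2,3], [1,3,2], [2,1,3]} \<Longrightarrow> F {[2,3,1], \<tau>} = series crosses (av_perms {[2,3,1], \<tau>})" for \<tau>
    by (rule F_eq_series; auto)+
  have Q: "?Q = fps_X * fps_quot 1 (1 - fps_X)" by (simp add: fps_quot_def)
  have "?Q * (1 - fps_X) = fps_X" by (rule fps_quot_mult) simp
  then have Q': "?Q = fps_X + fps_X * ?Q" by (simp add: algebra_simps)
  have "F {[3,1,2]} = fps_quot 1 (1 - fps_X * F {[2,3,1]})"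
    using equation_312 by (intro fps_quot_unique) (simp_all add: F algebra_simps)
  moreover have "F {[3,1,2], [1,2,3]} = 1 + ?Q\<^sup>2 + fps_X * F {[2,3,1], [1,2,3]}"
    using equation_312_123 by (simp add: F Q power2_eq_square mult_ac)
  moreover have "F {[3,1,2], [1,3,2]} = 1 + ?Q * F {[2,3,1], [1,3,2]}"
  proof -
    have "F {[3,1,2], [1,3,2]} = 1 + (fps_X + fps_X * ?Q) * F {[2,3,1], [1,3,2]}"
      using equation_312_132 by (simp add: F algebra_simps)
    then show ?thesis by (simp only: Q'[symmetric])
  qed
  moreover have "F {[3,1,2], [2,1,3]} = 1 + ?Q * F {[2,3,1], [2,1,3]}"
  proof -
    have "F {[3,1,2], [2,1,3]} - 1 = fps_quot (fps_X * F {[2,3,1], [2,1,3]}) (1 - fps_X)"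
      using equation_312_213 by (intro fps_quot_unique) (simp_all add: F algebra_simps)
    then show ?thesis by (simp add: fps_quot_def algebra_simps)
  qed
  moreover have "F {[2,3,1], [1,3,2]} = F {[2,3,1], [2,1,3]}"
    using series_231_132_eq_231_213 by (simp add: F)
  ultimately show ?thesis by auto
qed

end
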